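(* For all integers $a\geq 2$ and all $n\geq 124$, \[\mathrm{ex}_{\Pi}\Bigl(n, 5, \tbinom{5}{2}a +5\Bigr) = \Pi_{2,1}(a,n).\]
   Context: A multigraph is a pair $G=(V,w)$ where $V$ is a finite set and $w:\binom{V}{2}\to\mathbb{Z}_{\geq 0}$. For $X\subseteq V$ write $e(G[X])=\sum_{xy\in\binom{X}{2}}w(xy)$ and $P(G)=\prod_{xy\in\binom{V}{2}}w(xy)$. Given integers $s\geq 2$, $q\geq 0$, $\mathcal{F}(n,s,q)$ denotes the set of multigraphs on vertex set $[n]=\{1,\dots,n\}$ in which every $s$-set $X$ of vertices satisfies $e(G[X])\leq q$, and $\mathrm{ex}_{\Pi}(n,s,q)=\max\{P(G): G\in\mathcal{F}(n,s,q)\}$. For positive integers $a,r$, $d\in\{0,\dots,a-1\}$ and $n$, $\mathcal{T}_{r,d}(a,n)$ is the set of multigraphs $G$ on $[n]$ whose vertex set can be partitioned into $r$ parts $V_0,\dots,V_{r-1}$ such that all pairs inside $V_0$ have multiplicity $a-d$, all pairs inside $V_i$ ($1\le i\le r-1$) have multiplicity $a$, and all other pairs have multiplicity $a+1$. $\Pi_{r,d}(a,n)=\max\{P(G):G\in\mathcal{T}_{r,d}(a,n)\}$. *)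

theory Defs
  imports Main "HOL-Library.FuncSet" "HOL-Library.Disjoint_Sets"
begin

definition pairs :: "'a set \<Rightarrow> 'a set set" where
  "pairs V = {e. e \<subseteq> V \<and> card e = 2}"

text \<open>
  The multiplicity function is required to be extensional, so that it is determined by
  its values on the pairs of vertices and equality of multigraphs is the intended one.
\<close>

type_synonym 'a multigraph = "'a set \<times> ('a set \<Rightarrow> nat)"

abbreviation verts :: "'a multigraph \<Rightarrow> 'a set" where
  "verts G \<equiv> fst G"

abbreviation mult :: "'a multigraph \<Rightarrow> 'a set \<Rightarrow> nat" where
  "mult G \<equiv> snd G"

definition multigraph :: "'a multigraph \<Rightarrow> bool" where
  "multigraph G \<longleftrightarrow> finite (verts G) \<and> mult G \<in> extensional (pairs (verts G))"

definition edge_sum :: "'a multigraph \<Rightarrow> 'a set \<Rightarrow> nat" where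
  "edge_sum G X = (\<Sum>e\<in>pairs X. mult G e)"

definition edge_prod :: "'a multigraph \<Rightarrow> nat" where
  "edge_prod G = (\<Prod>e\<in>pairs (verts G). mult G e)"

definition sparse_multigraphs :: "nat \<Rightarrow> nat \<Rightarrow> nat \<Rightarrow> nat multigraph set" where
  "sparse_multigraphs n s q =
     {G. multigraph G \<and> verts G = {1..n} \<and>
         (\<forall>X. X \<subseteq> verts G \<and> card X = s \<longrightarrow> edge_sum G X \<le> q)}"

text \<open>
  For \<open>2 \<le> s \<le> n\<close> the maximum below ranges over a finite nonempty set
  (\<open>finite_sparse_multigraphs\<close>, \<open>sparse_multigraphs_nonempty\<close>).
\<close>

definition ex_prod :: "nat \<Rightarrow> nat \<Rightarrow> nat \<Rightarrow> nat" where
  "ex_prod n s q = Max (edge_prod ` sparse_multigraphs n s q)"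

text \<open>
  The parts are \<open>V 0, \<dots>, V (r - 1)\<close>; they are allowed to be empty. The parameters are
  meant to satisfy \<open>d < a\<close>, so that \<open>a - d\<close> is not truncated.
\<close>

definition turan_multigraphs :: "nat \<Rightarrow> nat \<Rightarrow> nat \<Rightarrow> nat \<Rightarrow> nat multigraph set" where
  "turan_multigraphs r d a n =
     {G. multigraph G \<and> verts G = {1..n} \<and>
         (\<exists>V :: nat \<Rightarrow> nat set.
            (\<Union>i<r. V i) = verts G \<and> disjoint_family_on V {..<r} \<and>
            (\<forall>e\<in>pairs (V 0). mult G e = a - d) \<and>
            (\<forall>i\<in>{1..<r}. \<forall>e\<in>pairs (V i). mult G e = a) \<and>
            (\<forall>e\<in>pairs (verts G) - (\<Union>i<r. pairs (V i)). mult G e = a + 1))}"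

definition turan_prod :: "nat \<Rightarrow> nat \<Rightarrow> nat \<Rightarrow> nat \<Rightarrow> nat" where
  "turan_prod r d a n = Max (edge_prod ` turan_multigraphs r d a n)"

lemma finite_pairs: "finite V \<Longrightarrow> finite (pairs V)"
  by (rule finite_subset[of _ "Pow V"]) (auto simp: pairs_def)

lemma finite_bounded_multigraphs:
  fixes n :: nat
  shows "finite {G. multigraph G \<and> verts G = {1..n} \<and> (\<forall>e\<in>pairs {1..n}. mult G e \<le> q)}"
proof (rule finite_subset)
  show "{G. multigraph G \<and> verts G = {1..n} \<and> (\<forall>e\<in>pairs {1..n}. mult G e \<le> q)}
      \<subseteq> {{1..n}} \<times> (\<Pi>\<^sub>E e\<in>pairs {1..n}. {..q})"
    by (auto simp: multigraph_def PiE_def)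
  show "finite ({{1..n}} \<times> (\<Pi>\<^sub>E e\<in>pairs {1..n}. {..q}))"
    by (intro finite_cartesian_product finite_PiE finite_pairs) auto
qed

lemma finite_sparse_multigraphs:
  assumes "2 \<le> s" "s \<le> n"
  shows "finite (sparse_multigraphs n s q)"
proof (rule finite_subset[OF _ finite_bounded_multigraphs[of n q]], safe)
  fix V w e
  assume G: "(V, w) \<in> sparse_multigraphs n s q" and e: "e \<in> pairs {1..n}"
  have "e \<subseteq> {1..n}" "card e = 2" using e by (auto simp: pairs_def)
  then obtain X where X: "e \<subseteq> X" "X \<subseteq> {1..n}" "card X = s"
    using exists_subset_between[of e s "{1..n}"] assms by auto
  have "finite X" using X(2) finite_subset by blast
  have "mult (V, w) e \<le> edge_sum (V, w) X"
    unfolding edge_sum_def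
    by (rule member_le_sum[OF _ _ finite_pairs])
      (use X \<open>card e = 2\<close> \<open>finite X\<close> in \<open>auto simp: pairs_def\<close>)
  also have "\<dots> \<le> q" using G X by (auto simp: sparse_multigraphs_def)
  finally show "mult (V, w) e \<le> q" .
qed (auto simp: sparse_multigraphs_def)

lemma sparse_multigraphs_nonempty: "sparse_multigraphs n s q \<noteq> {}"
proof -
  have "edge_sum ({1..n}, restrict (\<lambda>_. 0) (pairs {1..n})) X = 0" if "X \<subseteq> {1..n}" for X
    unfolding edge_sum_def using that by (intro sum.neutral) (auto simp: pairs_def)
  then have "({1..n}, restrict (\<lambda>_. 0) (pairs {1..n})) \<in> sparse_multigraphs n s q"
    by (auto simp: sparse_multigraphs_def multigraph_def)
  then show ?thesis by blast
qed

lemma finite_turan_multigraphs: "finite (turan_multigraphs r d a n)"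
proof (rule finite_subset[OF _ finite_bounded_multigraphs[of n "a + 1"]], safe)
  fix W w e
  assume G: "(W, w) \<in> turan_multigraphs r d a n" and e: "e \<in> pairs {1..n}"
  from G obtain V where V:
      "\<forall>e\<in>pairs (V 0). w e = a - d"
      "\<forall>i\<in>{1..<r}. \<forall>e\<in>pairs (V i). w e = a"
      "\<forall>e\<in>pairs {1..n} - (\<Union>i<r. pairs (V i)). w e = a + 1"
    unfolding turan_multigraphs_def by auto
  show "mult (W, w) e \<le> a + 1"
  proof (cases "\<exists>i<r. e \<in> pairs (V i)")
    case True
    then obtain i where i: "i < r" "e \<in> pairs (V i)" by blast
    then have "w e = a - d \<or> w e = a"
      using V(1) V(2)[rule_format, of i e] by (cases "i = 0") auto
    then show ?thesis by auto
  next
    case False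
    then show ?thesis using V(3) e by auto
  qed
qed (auto simp: turan_multigraphs_def)

lemma turan_multigraphs_nonempty:
  assumes "0 < r"
  shows "turan_multigraphs r d a n \<noteq> {}"
proof -
  have empty: "pairs ({} :: nat set) = {}" by (auto simp: pairs_def)
  have "({1..n}, restrict (\<lambda>_. a - d) (pairs {1..n})) \<in> turan_multigraphs r d a n"
    unfolding turan_multigraphs_def
    using assms
    by (auto simp: multigraph_def disjoint_family_on_def empty split: if_splits
        intro!: exI[of _ "\<lambda>i. if i = 0 then {1..n} else {}"])
  then show ?thesis by blast
qed

end

theory Submission
  imports Complex_Main Defs
begin

text \<open>
  Write a multiplicity as \<open>a + f\<close> and measure it by \<open>\<omega>\<close>, its logarithm to base \<open>(a + 1) / a\<close>
  normalised so that \<open>\<omega> = 0\<close> at \<open>f = 0\<close>. Then \<open>\<omega> \<le> f\<close>, and \<open>\<omega> \<le> -b\<close> when \<open>f < 0\<close>, for some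
  \<open>b\<close> between 1 and 7/4. With \<open>F n\<close> the maximum over \<open>k\<close> of \<open>k (n - k) - b (k choose 2)\<close>, the
  claim is that the total weight is at most \<open>F n\<close>.

  The proof is an induction on \<open>n\<close> with the bound \<open>max (F n) (90 + (\<lceil>1/4\<rceil> + \<dots> + \<lceil>n/4\<rceil>))\<close>, which
  grows by at least \<open>\<lceil>n/4\<rceil>\<close> at step \<open>n\<close> and equals \<open>F n\<close> once \<open>n \<ge> 124\<close>. A vertex of weight at
  most \<open>\<lceil>n/4\<rceil>\<close> can be deleted; so can a 4-set with \<open>f \<ge> 4\<close>, which by the condition on 5-sets
  contributes at most \<open>n\<close>, then a 3-set with \<open>f \<ge> 3\<close>, then a pair with \<open>f \<ge> 2\<close>. Otherwise the
  graph \<open>H\<close> of pairs with \<open>f = 1\<close> is triangle-free, each of its 4-cycles has a diagonal in the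
  graph \<open>D\<close> of pairs with \<open>f < 0\<close>, and \<open>H\<close>-degrees exceed \<open>D\<close>-degrees by more than \<open>n/4\<close>. Such
  a configuration is a \<open>D\<close>-clique together with an \<open>H\<close>-independent set, of weight at most \<open>F n\<close>.
\<close>

section \<open>Splitting sums and products over the pairs of a vertex set\<close>

text \<open>An image of the product \<open>A \<times> B\<close>: for disjoint \<open>A\<close> and
  \<open>B\<close> the map is injective, so sums reindex to double sums.\<close>

definition cross_pairs :: "'a set \<Rightarrow> 'a set \<Rightarrow> 'a set set" where
  "cross_pairs A B = (\<lambda>(x, y). {x, y}) ` (A \<times> B)"

lemma pairs_Un:
  assumes "A \<inter> B = {}"
  shows "pairs (A \<union> B) = pairs A \<union> pairs B \<union> cross_pairs A B"
proof
  show "pairs (A \<union> B) \<subseteq> pairs A \<union> pairs B \<union> cross_pairs A B"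
  proof
    fix e assume "e \<in> pairs (A \<union> B)"
    then obtain x y where e: "e = {x, y}" "x \<noteq> y" "x \<in> A \<union> B" "y \<in> A \<union> B"
      by (auto simp: pairs_def card_2_iff)
    then show "e \<in> pairs A \<union> pairs B \<union> cross_pairs A B"
      by (auto simp: pairs_def cross_pairs_def image_iff insert_commute)
  qed
  show "pairs A \<union> pairs B \<union> cross_pairs A B \<subseteq> pairs (A \<union> B)"
    using assms by (auto simp: pairs_def cross_pairs_def card_insert_if)
qed

lemma cross_pairs_disjoint:
  assumes "A \<inter> B = {}"
  shows "pairs A \<inter> pairs B = {}" "(pairs A \<union> pairs B) \<inter> cross_pairs A B = {}"
proof -
  show "pairs A \<inter> pairs B = {}"
  proof (rule ccontr)
    assume "pairs A \<inter> pairs B \<noteq> {}"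
    then obtain e where e: "e \<subseteq> A" "e \<subseteq> B" "card e = 2" by (auto simp: pairs_def)
    then have "e = {}" using assms by auto
    then show False using e by simp
  qed
  show "(pairs A \<union> pairs B) \<inter> cross_pairs A B = {}"
    using assms by (auto simp: pairs_def cross_pairs_def)
qed

lemma inj_on_cross_pairs:
  assumes "A \<inter> B = {}"
  shows "inj_on (\<lambda>(x, y). {x, y}) (A \<times> B)"
  using assms by (auto simp: inj_on_def doubleton_eq_iff)

lemma finite_cross_pairs: "finite A \<Longrightarrow> finite B \<Longrightarrow> finite (cross_pairs A B)"
  by (simp add: cross_pairs_def)

lemma card_cross_pairs:
  assumes "A \<inter> B = {}"
  shows "card (cross_pairs A B) = card A * card B"
  unfolding cross_pairs_def
  by (simp add: card_image[OF inj_on_cross_pairs[OF assms]] card_cartesian_product)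

lemma card_pairs: "finite A \<Longrightarrow> card (pairs A) = card A choose 2"
  by (simp add: pairs_def n_subsets)

lemma real_choose_2: "real (m choose 2) = real m * (real m - 1) / 2"
  by (induction m) (simp_all add: numeral_2_eq_2 field_simps)

lemma sum_pairs_split:
  fixes h :: "'a set \<Rightarrow> 'b::comm_monoid_add"
  assumes "finite A" "finite B" "A \<inter> B = {}"
  shows "sum h (pairs (A \<union> B)) = sum h (pairs A) + sum h (pairs B) + sum h (cross_pairs A B)"
  using assms cross_pairs_disjoint[OF assms(3)]
  by (simp add: pairs_Un sum.union_disjoint finite_pairs finite_cross_pairs)

lemma prod_pairs_split:
  fixes h :: "'a set \<Rightarrow> 'b::comm_monoid_mult"
  assumes "finite A" "finite B" "A \<inter> B = {}"
  shows "prod h (pairs (A \<union> B)) = prod h (pairs A) * prod h (pairs B) * prod h (cross_pairs A B)"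
  using assms cross_pairs_disjoint[OF assms(3)]
  by (simp add: pairs_Un prod.union_disjoint finite_pairs finite_cross_pairs)

lemma sum_cross_pairs:
  fixes h :: "'a set \<Rightarrow> 'b::comm_monoid_add"
  assumes "A \<inter> B = {}"
  shows "sum h (cross_pairs A B) = (\<Sum>x\<in>A. \<Sum>y\<in>B. h {x, y})"
  unfolding cross_pairs_def
  by (subst sum.reindex[OF inj_on_cross_pairs[OF assms]])
    (simp add: sum.cartesian_product case_prod_unfold comp_def)

lemma pairs_singleton [simp]: "pairs {x} = {}"
  by (auto simp: pairs_def card_2_iff)

lemma sum_pairs_insert:
  fixes h :: "'a set \<Rightarrow> 'b::comm_monoid_add"
  assumes "finite A" "v \<notin> A"
  shows "sum h (pairs (insert v A)) = sum h (pairs A) + (\<Sum>x\<in>A. h {v, x})"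
proof -
  have "sum h (pairs ({v} \<union> A)) = sum h (pairs {v}) + sum h (pairs A) + sum h (cross_pairs {v} A)"
    using assms by (intro sum_pairs_split) auto
  moreover have "sum h (cross_pairs {v} A) = (\<Sum>x\<in>{v}. \<Sum>y\<in>A. h {x, y})"
    using assms by (intro sum_cross_pairs) auto
  ultimately show ?thesis by simp
qed

lemma sum_pairs_remove:
  fixes h :: "'a set \<Rightarrow> 'b::comm_monoid_add"
  assumes "finite V" "v \<in> V"
  shows "sum h (pairs V) = sum h (pairs (V - {v})) + (\<Sum>x\<in>V - {v}. h {v, x})"
  using sum_pairs_insert[of "V - {v}" v h] assms by (simp add: insert_absorb)

text \<open>Double counting: each pair survives the deletion of every vertex except its own
  two.\<close>

lemma sum_pairs_vertex_deleted:
  fixes f :: "'a set \<Rightarrow> int"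
  assumes "finite V"
  shows "(\<Sum>v\<in>V. sum f (pairs (V - {v}))) = (int (card V) - 2) * sum f (pairs V)"
proof -
  have "sum f (pairs (V - {v})) = (\<Sum>e\<in>pairs V. if v \<in> e then 0 else f e)" for v
  proof -
    have "pairs (V - {v}) = {e \<in> pairs V. \<not> v \<in> e}" by (auto simp: pairs_def)
    then show ?thesis
      by (simp add: sum.inter_filter[OF finite_pairs[OF assms]] if_distrib cong: if_cong)
        (rule sum.cong; simp)
  qed
  then have "(\<Sum>v\<in>V. sum f (pairs (V - {v}))) = (\<Sum>e\<in>pairs V. \<Sum>v\<in>V. if v \<in> e then 0 else f e)"
    by (simp add: sum.swap[of _ V])
  also have "\<dots> = (\<Sum>e\<in>pairs V. (int (card V) - 2) * f e)"
  proof (rule sum.cong[OF refl])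
    fix e assume e: "e \<in> pairs V"
    then have "e \<subseteq> V" "card e = 2" by (auto simp: pairs_def)
    have "(\<Sum>v\<in>V. if v \<in> e then 0 else f e) = (\<Sum>v\<in>V - e. f e)"
      using assms by (intro sum.mono_neutral_cong_right) auto
    also have "\<dots> = (int (card V) - 2) * f e"
      using \<open>e \<subseteq> V\<close> \<open>card e = 2\<close> assms card_mono[OF assms \<open>e \<subseteq> V\<close>]
      by (simp add: card_Diff_subset finite_subset of_nat_diff)
    finally show "(\<Sum>v\<in>V. if v \<in> e then 0 else f e) = (int (card V) - 2) * f e" .
  qed
  finally show ?thesis by (simp add: sum_distrib_left)
qed

section \<open>Structure of the graphs \<open>H\<close> and \<open>D\<close>\<close>

text \<open>The vertices are split at \<open>D\<close>-degree \<open>k\<close>. A vertex of smaller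
  \<open>D\<close>-degree has a \<open>D\<close>-clique as its \<open>H\<close>-neighbourhood, which
  forces its \<open>H\<close>-neighbours above the threshold. Vertices above it have
  \<open>H\<close>-degree greater than \<open>2 * k\<close>, which leaves no room for two of them to
  be non-adjacent in \<open>D\<close>.\<close>

lemma clique_independent_partition:
  fixes H D :: "'a \<Rightarrow> 'a \<Rightarrow> bool"
  assumes fin: "finite V" and n: "card V \<le> 4 * k"
    and symH: "\<And>x y. H x y \<Longrightarrow> H y x" and symD: "\<And>x y. D x y \<Longrightarrow> D y x"
    and irrH: "\<And>x. \<not> H x x" and irrD: "\<And>x. \<not> D x x"
    and HD: "\<And>x y. H x y \<Longrightarrow> \<not> D x y"
    and tri: "\<And>x y z. \<lbrakk>x \<in> V; y \<in> V; z \<in> V; H x y; H y z\<rbrakk> \<Longrightarrow> \<not> H x z"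
    and C4: "\<And>u v x y. \<lbrakk>u \<in> V; v \<in> V; x \<in> V; y \<in> V; u \<noteq> v; x \<noteq> y; H u x; H u y; H v x; H v y\<rbrakk>
      \<Longrightarrow> D u v \<or> D x y"
    and deg: "\<And>v. v \<in> V \<Longrightarrow> k + 1 + card {u \<in> V. D v u} \<le> card {u \<in> V. H v u}"
  shows "\<exists>W\<subseteq>V. (\<forall>u\<in>W. \<forall>v\<in>W. u \<noteq> v \<longrightarrow> D u v) \<and> (\<forall>u\<in>V - W. \<forall>v\<in>V - W. \<not> H u v)"
proof -
  define N where "N v = {u \<in> V. H v u}" for v
  define E where "E v = {u \<in> V. D v u}" for v
  define W where "W = {v \<in> V. k \<le> card (E v)}"
  have finN: "finite (N v)" and finE: "finite (E v)" for v
    using fin by (auto simp: N_def E_def)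
  have deg': "k + 1 + card (E v) \<le> card (N v)" if "v \<in> V" for v
    using deg[OF that] by (simp add: N_def E_def)
  have symH': "H x y \<longleftrightarrow> H y x" and symD': "D x y \<longleftrightarrow> D y x" for x y
    using symH symD by blast+
  have NN: "N u \<inter> N v = {}" if "u \<in> V" "v \<in> V" "H u v" for u v
    using tri[of u v] that by (auto simp: N_def)
  have NV: "N v \<subseteq> V" and EV: "E v \<subseteq> V" for v by (auto simp: N_def E_def)
  have small: "D u u'" if v: "v \<in> V" "card (E v) < k" and u: "u \<in> N v" "u' \<in> N v" "u \<noteq> u'" for v u u'
  proof (rule ccontr)
    assume nD: "\<not> D u u'"
    \<comment> \<open>For a maximal \<open>D\<close>-independent \<open>I \<subseteq> N v\<close>, the sets \<open>N i - ({v} \<union> E v)\<close> with \<open>i \<in> I\<close> are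
      disjoint by the 4-cycle condition, and together they are too large when \<open>card I \<ge> 2\<close>.\<close>
    define t where "t = card (E v)"
    define S where "S = {I. I \<subseteq> N v \<and> (\<forall>x\<in>I. \<forall>y\<in>I. \<not> D x y)}"
    have "finite S" by (rule finite_subset[of _ "Pow (N v)"]) (auto simp: S_def finN)
    moreover have "{u, u'} \<in> S" using u nD irrD symD' by (auto simp: S_def)
    ultimately obtain I where I: "I \<in> S" "{u, u'} \<subseteq> I" and max: "\<And>J. J \<in> S \<Longrightarrow> I \<subseteq> J \<Longrightarrow> J = I"
      by (metis finite_has_maximal2)
    have IN: "I \<subseteq> N v" and finI: "finite I" using I finN finite_subset by (auto simp: S_def)
    define m where "m = card I"
    have m2: "2 \<le> m" using card_mono[OF finI I(2)] u by (simp add: m_def)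
    define P where "P i = N i - insert v (E v)" for i
    have "N v \<subseteq> (\<Union>i\<in>I. insert i (E i))"
    proof
      fix x assume x: "x \<in> N v"
      show "x \<in> (\<Union>i\<in>I. insert i (E i))"
      proof (rule ccontr)
        assume no: "x \<notin> (\<Union>i\<in>I. insert i (E i))"
        then have "\<not> D i x" if "i \<in> I" for i using that x NV[of v] by (auto simp: E_def)
        moreover from this have "\<not> D x i" if "i \<in> I" for i using that symD by blast
        ultimately have "insert x I \<in> S" using I(1) x irrD by (simp add: S_def)
        then have "insert x I = I" by (rule max) auto
        then show False using no by auto
      qed
    qed
    then have "card (N v) \<le> card (\<Union>i\<in>I. insert i (E i))"
      by (intro card_mono) (auto simp: finI finE)
    also have "\<dots> \<le> (\<Sum>i\<in>I. card (insert i (E i)))" by (rule card_UN_le[OF finI])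
    also have "\<dots> \<le> (\<Sum>i\<in>I. card (E i) + 1)" by (intro sum_mono) (simp add: card_insert_if finE)
    also have "\<dots> = (\<Sum>i\<in>I. card (E i)) + m" unfolding sum.distrib m_def by simp
    finally have cov: "card (N v) \<le> (\<Sum>i\<in>I. card (E i)) + m" .
    have "k + card (E i) \<le> card (P i) + t" if "i \<in> I" for i
    proof -
      have "i \<in> V" using that IN NV[of v] by blast
      have "card (N i) \<le> card (P i \<union> insert v (E v))"
        by (rule card_mono) (auto simp: P_def finN finE)
      also have "\<dots> \<le> card (P i) + card (insert v (E v))" by (rule card_Un_le)
      also have "\<dots> \<le> card (P i) + (t + 1)" by (simp add: card_insert_if finE t_def)
      finally show ?thesis using deg'[OF \<open>i \<in> V\<close>] by simp
    qed
    then have "(\<Sum>i\<in>I. k + card (E i)) \<le> (\<Sum>i\<in>I. card (P i) + t)" by (rule sum_mono)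
    then have sumP: "m * k + (\<Sum>i\<in>I. card (E i)) \<le> (\<Sum>i\<in>I. card (P i)) + m * t"
      by (simp add: sum.distrib m_def)
    have disjP: "P i \<inter> P j = {}" if "i \<in> I" "j \<in> I" "i \<noteq> j" for i j
    proof (rule ccontr)
      assume "P i \<inter> P j \<noteq> {}"
      then obtain c where c: "c \<in> N i" "c \<in> N j" "c \<noteq> v" "c \<notin> E v" by (auto simp: P_def)
      have "i \<in> N v" "j \<in> N v" "\<not> D i j" using that IN I(1) by (auto simp: S_def)
      then have "D v c" using C4[of i j v c] that c v symH' by (auto simp: N_def)
      then show False using c by (auto simp: N_def E_def)
    qed
    have "card (\<Union>i\<in>I. P i) = (\<Sum>i\<in>I. card (P i))"
      by (intro card_UN_disjoint ballI impI disjP) (auto simp: finI P_def finN)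
    moreover have "card (insert v (E v) \<union> N v \<union> (\<Union>i\<in>I. P i))
        = card (insert v (E v)) + card (N v) + card (\<Union>i\<in>I. P i)"
    proof -
      have 1: "insert v (E v) \<inter> N v = {}" using irrH HD by (auto simp: N_def E_def)
      \<comment> \<open>Each \<open>i \<in> I\<close> is an \<open>H\<close>-neighbour of
        \<open>v\<close>, so \<open>N i\<close> misses \<open>N v\<close> because \<open>H\<close>
        is triangle-free; \<open>P i\<close> misses the rest by definition.\<close>
      have 2: "(insert v (E v) \<union> N v) \<inter> (\<Union>i\<in>I. P i) = {}"
        using NN[of v] IN v by (auto simp: P_def N_def)
      show ?thesis
        using 1 2 by (subst card_Un_disjoint; (subst card_Un_disjoint)?)
          (auto simp: finI P_def finN finE)
    qed
    moreover have "card (insert v (E v) \<union> N v \<union> (\<Union>i\<in>I. P i)) \<le> card V"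
      using v NV EV by (intro card_mono[OF fin]) (auto simp: P_def)
    moreover have "card (insert v (E v)) = t + 1" using irrD by (simp add: finE t_def E_def fin)
    ultimately have tot: "t + 1 + card (N v) + (\<Sum>i\<in>I. card (P i)) \<le> 4 * k" using n by simp
    have dv: "k + 1 + t \<le> card (N v)" using deg'[OF v(1)] by (simp add: t_def)
    \<comment> \<open>Here \<open>s\<close> stands for \<open>k - t - 1\<close> without truncation.
      Eliminating the sums over \<open>I\<close> from \<open>tot\<close>, \<open>sumP\<close> and
      \<open>cov\<close> gives \<open>t + 1 + 2 * card (N v) + m * s \<le> 4 * k\<close>; with
      \<open>dv\<close> and \<open>m \<ge> 2\<close> the left side is at least
      \<open>4 * k + t + 1\<close>.\<close>
    obtain s where s: "k = t + 1 + s" using v(2) by (auto simp: t_def less_iff_Suc_add)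
    have "m * k = m * t + m + m * s" by (simp add: s algebra_simps)
    moreover have "2 * s \<le> m * s" using m2 by simp
    ultimately show False using tot sumP cov dv s m2 by linarith
  qed
  \<comment> \<open>\<open>N v\<close> is a \<open>D\<close>-clique containing \<open>u\<close>, so
    the \<open>D\<close>-degree of \<open>u\<close> is at least \<open>card (N v) - 1\<close>, hence
    at least \<open>k\<close>.\<close>
  have smallN: "u \<in> W" if "v \<in> V - W" "u \<in> N v" for v u
  proof -
    have v: "v \<in> V" "card (E v) < k" using that by (auto simp: W_def)
    have "N v - {u} \<subseteq> E u" using small[OF v] that NV by (auto simp: E_def)
    then have "card (N v - {u}) \<le> card (E u)" by (rule card_mono[OF finE])
    then have "k \<le> card (E u)" using deg'[OF v(1)] that finN by simp
    then show ?thesis using that NV by (auto simp: W_def)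
  qed
  \<comment> \<open>If \<open>u\<close> and \<open>v\<close> are not \<open>D\<close>-adjacent, any
    common \<open>H\<close>-neighbour \<open>c\<close> is \<open>D\<close>-adjacent to all the
    others. Its \<open>H\<close>-degree is then at least \<open>k + card ?C\<close>, and
    \<open>N c\<close> is disjoint from \<open>N u \<union> N v\<close>, so together they exceed
    \<open>4 * k\<close> vertices.\<close>
  have big: "D u v" if "u \<in> W" "v \<in> W" "u \<noteq> v" for u v
  proof (rule ccontr)
    assume nD: "\<not> D u v"
    have uv: "u \<in> V" "v \<in> V" "2 * k + 1 \<le> card (N u)" "2 * k + 1 \<le> card (N v)"
      using that deg' by (force simp: W_def)+
    let ?C = "N u \<inter> N v"
    have un: "card (N u \<union> N v) + card ?C = card (N u) + card (N v)"
      using card_Un_Int[OF finN finN, of u v] by simp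
    show False
    proof (cases "?C = {}")
      case True
      then show ?thesis using un uv n card_mono[OF fin, of "N u \<union> N v"] NV by simp
    next
      case False
      then obtain c where c: "c \<in> ?C" by blast
      then have cV: "c \<in> V" using NV by auto
      have "?C - {c} \<subseteq> E c"
      proof
        fix x assume "x \<in> ?C - {c}"
        then show "x \<in> E c" using C4[of u v c x] uv c nD that(3) by (auto simp: N_def E_def)
      qed
      then have "card (?C - {c}) \<le> card (E c)" by (rule card_mono[OF finE])
      moreover have "card (?C - {c}) + 1 = card ?C"
        using c finN by (metis Suc_eq_plus1 card_Suc_Diff1 finite_Int)
      ultimately have 1: "k + card ?C \<le> card (N c)" using deg'[OF cV] by linarith
      have "N c \<inter> (N u \<union> N v) = {}"
        using NN[of c u] NN[of c v] c cV uv symH' by (auto simp: N_def)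
      then have "card (N c \<union> (N u \<union> N v)) = card (N c) + card (N u \<union> N v)"
        by (intro card_Un_disjoint) (auto simp: finN)
      moreover have "card (N c \<union> (N u \<union> N v)) \<le> card V"
        using NV by (intro card_mono[OF fin]) auto
      ultimately show False using 1 un uv n by linarith
    qed
  qed
  have "\<not> H u v" if "u \<in> V - W" "v \<in> V - W" for u v
    using smallN[of u v] that by (auto simp: N_def)
  with big show ?thesis by (intro exI[of _ W]) (auto simp: W_def)
qed

section \<open>The extremal value and the bound used in the induction\<close>

text \<open>Total weight of the two-part construction with \<open>k\<close> vertices in the part
  \<open>V 0\<close>: weight 1 across, \<open>-b\<close> inside \<open>V 0\<close> and 0 inside the
  other part.\<close>

definition star_value :: "real \<Rightarrow> nat \<Rightarrow> nat \<Rightarrow> real" where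
  "star_value b n k = real k * (real n - real k) - b * (real k * (real k - 1) / 2)"

definition star_max :: "real \<Rightarrow> nat \<Rightarrow> real" where
  "star_max b n = Max (star_value b n ` {..n})"

text \<open>
  The constant 90 makes \<open>slow_bound\<close> dominate \<open>star_max\<close> up to \<open>n = 30\<close>, before which the
  increments of \<open>star_max\<close> may be too small, and still lets it fall below \<open>star_max\<close> by \<open>n = 124\<close>.
\<close>

definition slow_bound :: "nat \<Rightarrow> nat" where
  "slow_bound n = 90 + (\<Sum>i<n. i div 4 + 1)"

definition value_bound :: "real \<Rightarrow> nat \<Rightarrow> real" where
  "value_bound b n = max (star_max b n) (slow_bound n)"

lemma star_value_le_max: "k \<le> n \<Longrightarrow> star_value b n k \<le> star_max b n"
  unfolding star_max_def by (intro Max_ge) auto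

lemma star_max_attained:
  obtains k where "k \<le> n" "star_max b n = star_value b n k"
proof -
  have "star_max b n \<in> star_value b n ` {..n}"
    unfolding star_max_def by (intro Max_in) auto
  then show ?thesis using that by auto
qed

text \<open>A new vertex outside the part of optimal size \<open>k\<close> gains \<open>k\<close>.
  Comparing \<open>k\<close> with \<open>k + 1\<close> gives \<open>n - 1 \<le> (2 + b) * k\<close>,
  so \<open>k\<close> is at least \<open>4/15\<close> of \<open>n - 1\<close>; from
  \<open>n = 31\<close> on this yields \<open>n + 1 \<le> 4 * k\<close>.\<close>

lemma star_max_step:
  assumes b: "1 \<le> b" "b \<le> 7/4" and n: "31 \<le> n"
  shows "star_max b n + real (n div 4 + 1) \<le> star_max b (Suc n)"
proof -
  obtain k where k: "k \<le> n" "star_max b n = star_value b n k" by (rule star_max_attained)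
  have "real n - 1 \<le> (2 + b) * real k"
  proof (cases "k = n")
    case True
    have "1 * real n \<le> (2 + b) * real n" using b by (intro mult_right_mono) auto
    then show ?thesis using True by simp
  next
    case False
    then have "star_value b n (Suc k) \<le> star_value b n k"
      using k star_value_le_max[of "Suc k" n b] by simp
    then show ?thesis by (simp add: star_value_def field_simps)
  qed
  also have "\<dots> \<le> (15/4) * real k" using b by (intro mult_right_mono) auto
  finally have "n + 1 \<le> 4 * k" using n by linarith
  then have "n div 4 + 1 \<le> k" by linarith
  moreover have "star_value b (Suc n) k = star_value b n k + k"
    by (simp add: star_value_def algebra_simps)
  ultimately show ?thesis using star_value_le_max[of k "Suc n" b] k by linarith
qed

lemma slow_bound_Suc: "slow_bound (Suc n) = slow_bound n + (n div 4 + 1)"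
  by (simp add: slow_bound_def)

lemma slow_bound_4: "slow_bound (4 * q) = 90 + 2 * q * (q + 1)"
proof (induction q)
  case 0
  show ?case by (simp add: slow_bound_def)
next
  case (Suc q)
  have "4 * Suc q = Suc (Suc (Suc (Suc (4 * q))))" by simp
  then have "slow_bound (4 * Suc q) = slow_bound (Suc (Suc (Suc (Suc (4 * q)))))" by (rule arg_cong)
  also have "\<dots> = slow_bound (4 * q) + 4 * (q + 1)"
  proof -
    have "Suc (4 * q) div 4 = q" "Suc (Suc (4 * q)) div 4 = q" "Suc (Suc (Suc (4 * q))) div 4 = q"
      by presburger+
    then show ?thesis unfolding slow_bound_Suc by simp
  qed
  finally show ?case using Suc by simp
qed

lemma slow_bound_ge: "90 + (real n)\<^sup>2 / 8 \<le> slow_bound n"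
proof (induction n)
  case 0
  show ?case by (simp add: slow_bound_def)
next
  case (Suc n)
  have "n + 1 \<le> 4 * (n div 4 + 1)" by presburger
  then have "real (n + 1) \<le> real (4 * (n div 4 + 1))" by (rule of_nat_mono)
  then have "(real n + 1) / 4 \<le> real (n div 4 + 1)" by simp
  with Suc show ?case by (simp add: slow_bound_Suc power2_eq_square field_simps)
qed

text \<open>The value decreases in \<open>b\<close>, so \<open>b = 1\<close> is the worst case;
  there the quadratic in \<open>k\<close> peaks at \<open>(n + 1/2) / 3\<close>.\<close>

lemma star_max_le_slow_bound:
  assumes b: "1 \<le> b" and n: "n \<le> 30"
  shows "star_max b n \<le> slow_bound n"
proof -
  obtain k where k: "k \<le> n" "star_max b n = star_value b n k" by (rule star_max_attained)
  have "1 * (real k * (real k - 1) / 2) \<le> b * (real k * (real k - 1) / 2)"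
    using b by (intro mult_right_mono) (cases k; auto)+
  then have "star_value b n k \<le> real k * (real n - real k) - real k * (real k - 1) / 2"
    by (simp add: star_value_def)
  also have "\<dots> \<le> (real n + 1/2)\<^sup>2 / 6"
    using zero_le_power2[of "real n + 1/2 - 3 * real k"]
    by (simp add: power2_eq_square field_simps)
  also have "\<dots> \<le> 90 + (real n)\<^sup>2 / 8"
  proof -
    have "real n * real n \<le> 30 * 30" using n by (intro mult_mono) auto
    then show ?thesis using n by (simp add: power2_eq_square algebra_simps)
  qed
  finally show ?thesis using k slow_bound_ge[of n] by linarith
qed

lemma value_bound_step:
  assumes b: "1 \<le> b" "b \<le> 7/4"
  shows "value_bound b n + real (n div 4 + 1) \<le> value_bound b (Suc n)"
proof (cases "n \<le> 30")
  case True
  then have "value_bound b n = slow_bound n"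
    using star_max_le_slow_bound[OF b(1)] by (simp add: value_bound_def)
  then show ?thesis by (simp add: value_bound_def slow_bound_Suc)
next
  case False
  then show ?thesis
    using star_max_step[OF b, of n] by (simp add: value_bound_def slow_bound_Suc)
qed

text \<open>Pays for the deletion of a heavy 4-set: four consecutive increments add up to exactly
  \<open>n + 4\<close>.\<close>

lemma value_bound_step4:
  assumes b: "1 \<le> b" "b \<le> 7/4"
  shows "value_bound b n + real (n + 4) \<le> value_bound b (n + 4)"
proof -
  have "n div 4 + (n + 1) div 4 + (n + 2) div 4 + (n + 3) div 4 = n" by (induction n) simp_all
  then have "real (n div 4) + real ((n + 1) div 4) + real ((n + 2) div 4) + real ((n + 3) div 4) = real n"
    by (metis of_nat_add)
  moreover have "Suc n = n + 1" "Suc (n + 1) = n + 2" "Suc (n + 2) = n + 3" "Suc (n + 3) = n + 4"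
    by simp_all
  ultimately show ?thesis
    using value_bound_step[OF b, of n] value_bound_step[OF b, of "n + 1"]
      value_bound_step[OF b, of "n + 2"] value_bound_step[OF b, of "n + 3"]
    by (simp only: of_nat_add of_nat_1 of_nat_numeral)
qed

lemma value_bound_eq_star_max:
  assumes b: "1 \<le> b" "b \<le> 7/4" and n: "124 \<le> n"
  shows "value_bound b n = star_max b n"
proof -
  have "slow_bound n \<le> star_max b n" using n
  proof (induction n rule: dec_induct)
    case base
    have "slow_bound 124 = 2074" using slow_bound_4[of 31] by simp
    \<comment> \<open>The size 33 is close to optimal for \<open>b = 7/4\<close>, the worst case,
      where the value is 2079.\<close>
    moreover have "2074 \<le> star_value b 124 33" using b by (simp add: star_value_def)
    ultimately show ?case using star_value_le_max[of 33 124 b] by simp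
  next
    case (step n)
    then show ?case using star_max_step[OF b, of n] by (simp add: slow_bound_Suc)
  qed
  then show ?thesis by (simp add: value_bound_def)
qed

section \<open>The weight bound by induction on the number of vertices\<close>

text \<open>If \<open>X\<close> carries \<open>s\<close>, each outside vertex sends at most
  \<open>q - s\<close> to it. As \<open>X\<close> is a proper subset, any excess of \<open>s\<close>
  over \<open>p\<close> is lost again at one or more outside vertices, so \<open>s\<close> may be
  replaced by \<open>p\<close>.\<close>

lemma heavy_set_removal:
  fixes f :: "'a set \<Rightarrow> int" and \<omega> :: "'a set \<Rightarrow> real"
  assumes fin: "finite V" and X: "X \<subset> V"
    and le: "\<And>e. e \<in> pairs V \<Longrightarrow> \<omega> e \<le> f e"
    and heavy: "p \<le> sum f (pairs X)"
    and ext: "\<And>v. v \<in> V - X \<Longrightarrow> sum f (pairs (insert v X)) \<le> q"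
  shows "sum \<omega> (pairs V) \<le> sum \<omega> (pairs (V - X)) + of_int (p + int (card V - card X) * (q - p))"
proof -
  let ?s = "sum f (pairs X)"
  have finX: "finite X" using fin X finite_subset by blast
  have V: "V = (V - X) \<union> X" using X by auto
  have card: "card (V - X) = card V - card X" using X finX by (simp add: card_Diff_subset)
  have pos: "1 \<le> int (card (V - X))"
    using X fin card_gt_0_iff[of "V - X"] by auto
  have pX: "pairs X \<subseteq> pairs V" using X by (auto simp: pairs_def)
  have cX: "cross_pairs (V - X) X \<subseteq> pairs V"
    using pairs_Un[of "V - X" X] V by auto
  have "sum \<omega> (pairs V) = sum \<omega> (pairs (V - X)) + sum \<omega> (pairs X) + sum \<omega> (cross_pairs (V - X) X)"
    using sum_pairs_split[of "V - X" X \<omega>] fin finX V by auto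
  moreover have "sum \<omega> (pairs X) \<le> of_int ?s"
    unfolding of_int_sum using le pX by (intro sum_mono) auto
  moreover have "sum \<omega> (cross_pairs (V - X) X) \<le> of_int (sum f (cross_pairs (V - X) X))"
    unfolding of_int_sum using le cX by (intro sum_mono) auto
  moreover have "sum f (cross_pairs (V - X) X) \<le> int (card (V - X)) * (q - ?s)"
  proof -
    have "sum f (cross_pairs (V - X) X) = (\<Sum>v\<in>V - X. \<Sum>x\<in>X. f {v, x})"
      by (rule sum_cross_pairs) auto
    also have "\<dots> \<le> (\<Sum>v\<in>V - X. q - ?s)"
    proof (rule sum_mono)
      fix v assume v: "v \<in> V - X"
      then show "(\<Sum>x\<in>X. f {v, x}) \<le> q - ?s"
        using ext[OF v] sum_pairs_insert[OF finX, of v f] by auto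
    qed
    finally show ?thesis by simp
  qed
  moreover have "?s + int (card (V - X)) * (q - ?s) \<le> p + int (card (V - X)) * (q - p)"
    using mult_right_mono[OF pos, of "?s - p"] heavy by (simp add: algebra_simps)
  ultimately show ?thesis unfolding card[symmetric] by linarith
qed

text \<open>Averaging over vertex deletions keeps the density bound of the 5-sets; it serves the
  base cases of the induction.\<close>

lemma averaged_edge_sum:
  fixes f :: "'a set \<Rightarrow> int"
  assumes "finite V" "5 \<le> card V"
    and "\<And>X. X \<subseteq> V \<Longrightarrow> card X = 5 \<Longrightarrow> sum f (pairs X) \<le> 5"
  shows "4 * sum f (pairs V) \<le> int (card V) * (int (card V) - 1)"
  using assms
proof (induction "card V" arbitrary: V rule: less_induct)
  case less
  let ?n = "int (card V)"
  show ?case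
  proof (cases "card V = 5")
    case True
    then show ?thesis using less(4)[of V] by simp
  next
    case False
    then have n: "6 \<le> card V" using less by simp
    have "(?n - 2) * (4 * sum f (pairs V)) = (\<Sum>v\<in>V. 4 * sum f (pairs (V - {v})))"
      using sum_pairs_vertex_deleted[OF less(2), of f] by (simp add: sum_distrib_left[symmetric])
    also have "\<dots> \<le> (\<Sum>v\<in>V. (?n - 1) * (?n - 2))"
    proof (rule sum_mono)
      fix v assume v: "v \<in> V"
      have c: "card (V - {v}) = card V - 1" using v less by simp
      have "4 * sum f (pairs (V - {v})) \<le> int (card (V - {v})) * (int (card (V - {v})) - 1)"
        by (rule less.hyps) (use c n less in auto)
      then show "4 * sum f (pairs (V - {v})) \<le> (?n - 1) * (?n - 2)"
        using c n by (simp add: of_nat_diff)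
    qed
    also have "\<dots> = (?n - 2) * (?n * (?n - 1))" by (simp add: algebra_simps)
    finally show ?thesis using n by (simp add: mult_le_cancel_left)
  qed
qed

text \<open>The case in which nothing can be deleted. The bounds on 3-sets and 4-sets become the
  triangle and 4-cycle conditions, and the resulting partition has the weights of the two-part
  construction as upper bounds.\<close>

lemma light_sets_bound:
  fixes f :: "'a set \<Rightarrow> int" and \<omega> :: "'a set \<Rightarrow> real"
  assumes b: "1 \<le> b" and fin: "finite V" and n: "card V \<le> 4 * k"
    and le: "\<And>e. e \<in> pairs V \<Longrightarrow> \<omega> e \<le> f e"
    and neg: "\<And>e. e \<in> pairs V \<Longrightarrow> f e \<le> -1 \<Longrightarrow> \<omega> e \<le> -b"
    and two: "\<And>e. e \<in> pairs V \<Longrightarrow> f e \<le> 1"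
    and three: "\<And>X. X \<subseteq> V \<Longrightarrow> card X = 3 \<Longrightarrow> sum f (pairs X) \<le> 2"
    and four: "\<And>X. X \<subseteq> V \<Longrightarrow> card X = 4 \<Longrightarrow> sum f (pairs X) \<le> 3"
    and deg: "\<And>v. v \<in> V \<Longrightarrow> real k < (\<Sum>x\<in>V - {v}. \<omega> {v, x})"
  shows "sum \<omega> (pairs V) \<le> star_max b (card V)"
proof -
  define H where "H x y \<longleftrightarrow> x \<noteq> y \<and> f {x, y} = 1" for x y
  define D where "D x y \<longleftrightarrow> x \<noteq> y \<and> f {x, y} \<le> -1" for x y
  have pV: "{x, y} \<in> pairs V" if "x \<in> V" "y \<in> V" "x \<noteq> y" for x y
    using that by (auto simp: pairs_def)
  have "\<exists>W\<subseteq>V. (\<forall>u\<in>W. \<forall>v\<in>W. u \<noteq> v \<longrightarrow> D u v) \<and> (\<forall>u\<in>V - W. \<forall>v\<in>V - W. \<not> H u v)"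
  proof (rule clique_independent_partition[OF fin n, of H D])
    show "H y x" if "H x y" for x y using that by (auto simp: H_def insert_commute)
    show "D y x" if "D x y" for x y using that by (auto simp: D_def insert_commute)
    show "\<not> H x x" "\<not> D x x" for x by (auto simp: H_def D_def)
    show "\<not> D x y" if "H x y" for x y using that by (auto simp: H_def D_def)
    show tri: "\<not> H x z" if "x \<in> V" "y \<in> V" "z \<in> V" "H x y" "H y z" for x y z
    proof
      assume xz: "H x z"
      have "sum f (pairs {x, y, z}) = f {y, z} + (f {x, y} + f {x, z})"
        using that xz by (simp add: sum_pairs_insert H_def)
      then have "sum f (pairs {x, y, z}) = 3" using that xz by (simp add: H_def)
      moreover have "card {x, y, z} = 3" using that xz by (simp add: H_def)
      ultimately show False using three[of "{x, y, z}"] that by simp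
    qed
    show "D u v \<or> D x y"
      if *: "u \<in> V" "v \<in> V" "x \<in> V" "y \<in> V" "u \<noteq> v" "x \<noteq> y" "H u x" "H u y" "H v x" "H v y"
      for u v x y
    proof (rule ccontr)
      assume "\<not> (D u v \<or> D x y)"
      then have nD: "0 \<le> f {u, v}" "0 \<le> f {x, y}" using * by (auto simp: D_def)
      have "sum f (pairs {u, v, x, y}) = f {x, y} + (f {v, x} + f {v, y}) + (f {u, v} + (f {u, x} + f {u, y}))"
        using * by (simp add: sum_pairs_insert H_def)
      then have "4 \<le> sum f (pairs {u, v, x, y})" using * nD by (simp add: H_def)
      moreover have "card {u, v, x, y} = 4" using * by (simp add: H_def)
      ultimately show False using four[of "{u, v, x, y}"] * by simp
    qed
    show "k + 1 + card {u \<in> V. D v u} \<le> card {u \<in> V. H v u}" if v: "v \<in> V" for v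
    proof -
      let ?c = "\<lambda>x. (if H v x then 1 else 0 :: real) - b * (if D v x then 1 else 0)"
      have "(\<Sum>x\<in>V - {v}. \<omega> {v, x}) \<le> (\<Sum>x\<in>V - {v}. ?c x)"
      proof (rule sum_mono)
        fix x assume x: "x \<in> V - {v}"
        then have p: "{v, x} \<in> pairs V" using pV v by auto
        then show "\<omega> {v, x} \<le> ?c x"
          using le[OF p] neg[OF p] two[OF p] x by (auto simp: H_def D_def)
      qed
      also have "\<dots> = real (card {u \<in> V. H v u}) - b * real (card {u \<in> V. D v u})"
      proof -
        have "(\<Sum>x\<in>V - {v}. if P x then 1 else 0 :: real) = real (card {u \<in> V. P u})" if "\<not> P v" for P
        proof -
          have "{u \<in> V. P u} = (V - {v}) \<inter> {u. P u}" using that by auto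
          then show ?thesis using fin by (simp add: sum.If_cases)
        qed
        from this[of "H v"] this[of "D v"] show ?thesis
          by (simp add: sum_subtractf sum_distrib_left[symmetric] H_def D_def)
      qed
      also have "\<dots> \<le> real (card {u \<in> V. H v u}) - real (card {u \<in> V. D v u})"
        using mult_right_mono[OF b, of "real (card {u \<in> V. D v u})"] by simp
      \<comment> \<open>Strictness matters: a difference of integers above \<open>k\<close> is at
        least \<open>k + 1\<close>.\<close>
      finally show ?thesis using deg[OF v] by linarith
    qed
  qed
  then obtain W where W: "W \<subseteq> V" "\<And>u v. \<lbrakk>u \<in> W; v \<in> W; u \<noteq> v\<rbrakk> \<Longrightarrow> D u v"
    "\<And>u v. \<lbrakk>u \<in> V - W; v \<in> V - W\<rbrakk> \<Longrightarrow> \<not> H u v"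
    by (elim exE conjE) simp
  let ?U = "V - W"
  have finW: "finite W" using W fin finite_subset by blast
  have V: "V = W \<union> ?U" using W by auto
  have wn: "card W \<le> card V" using W fin by (simp add: card_mono)
  have "sum \<omega> (pairs V) = sum \<omega> (pairs W) + sum \<omega> (pairs ?U) + sum \<omega> (cross_pairs W ?U)"
    using sum_pairs_split[of W ?U \<omega>] fin finW V by auto
  moreover have "sum \<omega> (pairs W) \<le> - (b * (real (card W) * (real (card W) - 1) / 2))"
  proof -
    have "sum \<omega> (pairs W) \<le> (\<Sum>e\<in>pairs W. - b)"
    proof (rule sum_mono)
      fix e assume "e \<in> pairs W"
      then obtain x y where e: "e = {x, y}" "x \<noteq> y" "x \<in> W" "y \<in> W"
        by (auto simp: pairs_def card_2_iff)
      then show "\<omega> e \<le> - b" using W(1) W(2)[of x y] neg[of e] pV[of x y] by (auto simp: D_def)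
    qed
    also have "\<dots> = - (b * real (card W choose 2))" by (simp add: card_pairs finW)
    finally show ?thesis by (simp add: real_choose_2)
  qed
  moreover have "sum \<omega> (pairs ?U) \<le> 0"
  proof (rule sum_nonpos)
    fix e assume "e \<in> pairs ?U"
    then obtain x y where e: "e = {x, y}" "x \<noteq> y" "x \<in> ?U" "y \<in> ?U"
      by (auto simp: pairs_def card_2_iff)
    then have "e \<in> pairs V" "f e \<noteq> 1" using W(3)[of x y] pV[of x y] by (auto simp: H_def)
    then show "\<omega> e \<le> 0" using le[of e] two[of e] by linarith
  qed
  moreover have "sum \<omega> (cross_pairs W ?U) \<le> real (card W) * (real (card V) - real (card W))"
  proof -
    have "sum \<omega> (cross_pairs W ?U) \<le> (\<Sum>e\<in>cross_pairs W ?U. 1)"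
    proof (rule sum_mono)
      fix e assume "e \<in> cross_pairs W ?U"
      then have "e \<in> pairs V" using pairs_Un[of W ?U] V by auto
      then show "\<omega> e \<le> 1" using le[of e] two[of e] by linarith
    qed
    also have "\<dots> = real (card W * card ?U)" by (simp add: card_cross_pairs)
    finally show ?thesis using W finW wn by (simp add: card_Diff_subset of_nat_diff)
  qed
  ultimately have "sum \<omega> (pairs V) \<le> star_value b (card V) (card W)"
    by (simp add: star_value_def)
  then show ?thesis using star_value_le_max[OF wn, of b] by linarith
qed

lemma total_weight_le_value_bound:
  fixes f :: "'a set \<Rightarrow> int" and \<omega> :: "'a set \<Rightarrow> real"
  assumes b: "1 \<le> b" "b \<le> 7/4"
    and "finite V" "5 \<le> card V"
    and "\<And>e. e \<in> pairs V \<Longrightarrow> \<omega> e \<le> f e"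
    and "\<And>e. e \<in> pairs V \<Longrightarrow> f e \<le> -1 \<Longrightarrow> \<omega> e \<le> -b"
    and "\<And>X. X \<subseteq> V \<Longrightarrow> card X = 5 \<Longrightarrow> sum f (pairs X) \<le> 5"
  shows "sum \<omega> (pairs V) \<le> value_bound b (card V)"
  using assms(3-)
proof (induction "card V" arbitrary: V rule: less_induct)
  case less
  note fin = less(2) and le = less(4) and neg = less(5) and five = less(6)
  let ?n = "card V"
  show ?case
  \<comment> \<open>Deleting up to four of nine or more vertices leaves the five required by the
    induction hypothesis. With at most eight vertices, averaging gives weight at most 14, below the
    constant 90.\<close>
  proof (cases "?n \<le> 8")
    case True
    have "sum \<omega> (pairs V) \<le> of_int (sum f (pairs V))"
      unfolding of_int_sum using le by (intro sum_mono) auto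
    moreover have "4 * sum f (pairs V) \<le> int ?n * (int ?n - 1)"
      by (rule averaged_edge_sum[OF fin less(3) five])
    moreover have "int ?n * (int ?n - 1) \<le> 8 * 7"
      using True less(3) by (intro mult_mono) auto
    moreover have "90 \<le> value_bound b ?n"
      by (simp add: value_bound_def slow_bound_def le_max_iff_disj sum_nonneg)
    ultimately show ?thesis by linarith
  next
    case False
    then have n: "9 \<le> ?n" by simp
    have sub: "sum \<omega> (pairs (V - X)) \<le> value_bound b (?n - card X)"
      if X: "X \<subseteq> V" "1 \<le> card X" "card X \<le> 4" for X
    proof -
      have c: "card (V - X) = ?n - card X"
        using X fin by (simp add: card_Diff_subset finite_subset)
      have p: "pairs (V - X) \<subseteq> pairs V" by (auto simp: pairs_def)
      have five': "sum f (pairs Y) \<le> 5" if "Y \<subseteq> V - X" "card Y = 5" for Y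
        using five[of Y] that by blast
      have "sum \<omega> (pairs (V - X)) \<le> value_bound b (card (V - X))"
        by (rule less.hyps) (use c n X fin le neg five' p in auto)
      then show ?thesis using c by simp
    qed
    have rem: "sum \<omega> (pairs V) \<le> value_bound b (?n - card X) + of_int (p + int (?n - card X) * (q - p))"
      if "X \<subseteq> V" "1 \<le> card X" "card X \<le> 4" "p \<le> sum f (pairs X)"
        "\<And>v. v \<in> V - X \<Longrightarrow> sum f (pairs (insert v X)) \<le> q" for X p q
    proof -
      have "X \<noteq> V" using that n by auto
      then have "X \<subset> V" using that by auto
      then show ?thesis using heavy_set_removal[OF fin _ le that(4) that(5)] sub[OF that(1-3)] by fastforce
    qed
    have cins: "card (insert v X) = Suc (card X)" "insert v X \<subseteq> V"
      if "X \<subseteq> V" "v \<in> V - X" for v X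
      using that fin finite_subset[of X V] by auto
    have step: "value_bound b m + 1 \<le> value_bound b (Suc m)" for m
      using value_bound_step[OF b, of m] by linarith
    show ?thesis
    proof (cases "\<exists>X\<subseteq>V. card X = 4 \<and> 4 \<le> sum f (pairs X)")
      case True
      then obtain X where X: "X \<subseteq> V" "card X = 4" "4 \<le> sum f (pairs X)" by blast
      \<comment> \<open>The 5-set condition gives \<open>q = 5\<close>, so the loss is
        \<open>4 + (?n - 4)\<close>, exactly what four steps of the bound provide.\<close>
      have "sum \<omega> (pairs V) \<le> value_bound b (?n - card X) + of_int (4 + int (?n - card X) * (5 - 4))"
        by (rule rem) (use X cins five in auto)
      then have "sum \<omega> (pairs V) \<le> value_bound b (?n - 4) + real (?n - 4 + 4)"
        using X(2) by simp
      then show ?thesis using value_bound_step4[OF b, of "?n - 4"] n by simp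
    next
      case no4: False
      then have four: "\<And>X. X \<subseteq> V \<Longrightarrow> card X = 4 \<Longrightarrow> sum f (pairs X) \<le> 3" by force
      show ?thesis
      proof (cases "\<exists>X\<subseteq>V. card X = 3 \<and> 3 \<le> sum f (pairs X)")
        case True
        then obtain X where X: "X \<subseteq> V" "card X = 3" "3 \<le> sum f (pairs X)" by blast
        \<comment> \<open>With heavy 4-sets excluded, \<open>p = q = 3\<close>: outside vertices
          contribute nothing positive, and three steps of at least 1 suffice. Pairs are treated
          alike below with \<open>p = q = 2\<close>.\<close>
        have "sum \<omega> (pairs V) \<le> value_bound b (?n - card X) + of_int (3 + int (?n - card X) * (3 - 3))"
          by (rule rem) (use X cins four in auto)
        moreover have "?n = Suc (Suc (Suc (?n - 3)))" using n by simp
        ultimately show ?thesis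
          using X(2) step[of "?n - 3"] step[of "Suc (?n - 3)"] step[of "Suc (Suc (?n - 3))"] by simp
      next
        case no3: False
        then have three: "\<And>X. X \<subseteq> V \<Longrightarrow> card X = 3 \<Longrightarrow> sum f (pairs X) \<le> 2" by force
        show ?thesis
        proof (cases "\<exists>e\<in>pairs V. 2 \<le> f e")
          case True
          then obtain e where e: "e \<subseteq> V" "card e = 2" "2 \<le> f e" by (auto simp: pairs_def)
          have "pairs e = {e}"
            using e(2) by (auto simp: pairs_def card_2_iff)
          have "sum \<omega> (pairs V) \<le> value_bound b (?n - card e) + of_int (2 + int (?n - card e) * (2 - 2))"
            by (rule rem) (use e cins three \<open>pairs e = {e}\<close> in auto)
          moreover have "?n = Suc (Suc (?n - 2))" using n by simp
          ultimately show ?thesis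
            using e(2) step[of "?n - 2"] step[of "Suc (?n - 2)"] by simp
        next
          case no2: False
          then have two: "\<And>e. e \<in> pairs V \<Longrightarrow> f e \<le> 1" by force
          \<comment> \<open>This is \<open>?n / 4\<close> rounded up: both the last increment of the
            bound and a value with \<open>?n \<le> 4 * ?k\<close>.\<close>
          let ?k = "(?n - 1) div 4 + 1"
          show ?thesis
          proof (cases "\<exists>v\<in>V. (\<Sum>x\<in>V - {v}. \<omega> {v, x}) \<le> real ?k")
            case True
            then obtain v where v: "v \<in> V" "(\<Sum>x\<in>V - {v}. \<omega> {v, x}) \<le> real ?k" by blast
            have "sum \<omega> (pairs V) = sum \<omega> (pairs (V - {v})) + (\<Sum>x\<in>V - {v}. \<omega> {v, x})"
              by (rule sum_pairs_remove[OF fin v(1)])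
            moreover have "sum \<omega> (pairs (V - {v})) \<le> value_bound b (?n - 1)"
              using sub[of "{v}"] v by simp
            moreover have "value_bound b (?n - 1) + real ?k \<le> value_bound b ?n"
              using value_bound_step[OF b, of "?n - 1"] n by simp
            ultimately show ?thesis using v(2) by linarith
          next
            case False
            have "?n \<le> 4 * ?k" by presburger
            moreover have "real ?k < (\<Sum>x\<in>V - {v}. \<omega> {v, x})" if "v \<in> V" for v
              using False that not_le by blast
            ultimately have "sum \<omega> (pairs V) \<le> star_max b ?n"
              using light_sets_bound[OF b(1) fin _ le neg two three four] by blast
            then show ?thesis by (simp add: value_bound_def)
          qed
        qed
      qed
    qed
  qed
qed

section \<open>Sparsity and products of the two-part multigraphs\<close>

text \<open>Stated for subsets of the parts, to serve both the traces of a 5-set and the whole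
  parts.\<close>

lemma turan_mult_cross:
  assumes V: "V 0 \<inter> V (1::nat) = {}" and AB: "A \<subseteq> V 0" "B \<subseteq> V 1"
  assumes "V 0 \<union> V 1 \<subseteq> U"
    and "\<forall>e\<in>pairs U - (\<Union>i<2. pairs (V i)). w e = c"
  shows "\<forall>e\<in>cross_pairs A B. w e = c"
proof
  fix e assume e: "e \<in> cross_pairs A B"
  then obtain x y where xy: "e = {x, y}" "x \<in> A" "y \<in> B" by (auto simp: cross_pairs_def)
  then have "x \<noteq> y" "x \<notin> V 1" "y \<notin> V 0" using V AB by auto
  then have "e \<in> pairs U - (\<Union>i<2. pairs (V i))"
    using xy assms(4) AB by (auto simp: pairs_def numeral_2_eq_2 less_Suc_eq)
  then show "w e = c" using assms(5) by blast
qed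

text \<open>A 5-set with \<open>i\<close> vertices in \<open>V 0\<close> exceeds
  \<open>10 * a\<close> by \<open>i * (5 - i) - (i choose 2)\<close>, whose largest value is 5, at
  \<open>i = 2\<close>.\<close>

lemma turan_multigraphs_sparse:
  assumes a: "a \<ge> 2"
  shows "turan_multigraphs 2 1 a n \<subseteq> sparse_multigraphs n 5 (10 * a + 5)"
proof
  fix G assume G: "G \<in> turan_multigraphs 2 1 a n"
  then obtain V :: "nat \<Rightarrow> nat set" where mg: "multigraph G" "verts G = {1..n}"
    and V: "(\<Union>i<2. V i) = verts G" "disjoint_family_on V {..<2}"
      "\<forall>e\<in>pairs (V 0). mult G e = a - 1"
      "\<forall>i\<in>{1..<2}. \<forall>e\<in>pairs (V i). mult G e = a"
      "\<forall>e\<in>pairs (verts G) - (\<Union>i<2. pairs (V i)). mult G e = a + 1"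
    unfolding turan_multigraphs_def by blast
  have V01: "V 0 \<union> V 1 = verts G" "V 0 \<inter> V 1 = {}"
    using V(1,2) by (auto simp: disjoint_family_on_def lessThan_nat_numeral lessThan_Suc)
  have "edge_sum G X \<le> 10 * a + 5" if X: "X \<subseteq> verts G" "card X = 5" for X
  proof -
    define A B where "A = X \<inter> V 0" and "B = X \<inter> V 1"
    have finX: "finite X" using X(2) by (metis card.infinite zero_neq_numeral)
    have AB: "X = A \<union> B" "A \<inter> B = {}" "finite A" "finite B"
      using V01 X finX by (auto simp: A_def B_def)
    have "card A + card B = 5" using AB X(2) card_Un_disjoint by metis
    have cr: "\<forall>e\<in>cross_pairs A B. mult G e = a + 1"
      by (rule turan_mult_cross[OF V01(2) _ _ _ V(5)]) (use V01 in \<open>auto simp: A_def B_def\<close>)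
    have "edge_sum G X = sum (mult G) (pairs A) + sum (mult G) (pairs B) + sum (mult G) (cross_pairs A B)"
      unfolding edge_sum_def using AB by (simp add: sum_pairs_split)
    also have "sum (mult G) (pairs A) = (\<Sum>e\<in>pairs A. a - 1)"
      using V(3) by (intro sum.cong) (auto simp: A_def pairs_def)
    also have "sum (mult G) (pairs B) = (\<Sum>e\<in>pairs B. a)"
      using bspec[OF V(4), of 1] by (intro sum.cong) (auto simp: B_def pairs_def)
    also have "sum (mult G) (cross_pairs A B) = (\<Sum>e\<in>cross_pairs A B. a + 1)"
      using cr by (intro sum.cong) auto
    finally have eq: "edge_sum G X = (card A choose 2) * (a - 1) + (card B choose 2) * a
        + card A * card B * (a + 1)"
      using AB by (simp add: card_pairs card_cross_pairs)
    have B: "card B = 5 - card A" and "card A \<le> 5" using \<open>card A + card B = 5\<close> by auto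
    then have "card A = 0 \<or> card A = 1 \<or> card A = 2 \<or> card A = 3 \<or> card A = 4 \<or> card A = 5" by auto
    then show ?thesis
      using a unfolding eq B by (elim disjE) (simp_all add: choose_two)
  qed
  then show "G \<in> sparse_multigraphs n 5 (10 * a + 5)"
    using mg by (auto simp: sparse_multigraphs_def)
qed

lemma turan_prod_ge:
  assumes k: "k \<le> n"
  shows "(a - 1) ^ (k choose 2) * a ^ ((n - k) choose 2) * (a + 1) ^ (k * (n - k)) \<le> turan_prod 2 1 a n"
proof -
  define V :: "nat \<Rightarrow> nat set" where "V i = (if i = 0 then {1..k} else {k<..n})" for i
  define w where "w = restrict (\<lambda>e. if e \<subseteq> V 0 then a - 1 else if e \<subseteq> V 1 then a else a + 1) (pairs {1..n})"
  define G where "G = ({1..n}, w)"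
  have V01: "V 0 \<union> V 1 = {1..n}" "V 0 \<inter> V 1 = {}" "finite (V 0)" "finite (V 1)"
    "card (V 0) = k" "card (V 1) = n - k"
    using k by (auto simp: V_def)
  have p: "pairs (V 0) \<subseteq> pairs {1..n}" "pairs (V 1) \<subseteq> pairs {1..n}" 
    using V01(1) by (auto simp: pairs_def)
  have w0: "\<forall>e\<in>pairs (V 0). w e = a - 1"
    using p by (auto simp: w_def pairs_def)
  have w1: "\<forall>e\<in>pairs (V 1). w e = a"
  proof
    fix e assume e: "e \<in> pairs (V 1)"
    moreover have "e \<notin> pairs (V 0)" using e cross_pairs_disjoint(1)[OF V01(2)] by auto
    ultimately show "w e = a" using p by (auto simp: w_def pairs_def)
  qed
  have w2: "\<forall>e\<in>pairs {1..n} - (\<Union>i<2. pairs (V i)). w e = a + 1"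
    by (auto simp: w_def pairs_def lessThan_nat_numeral lessThan_Suc)
  have "G \<in> turan_multigraphs 2 1 a n"
    unfolding turan_multigraphs_def mem_Collect_eq
  proof (intro conjI exI[of _ V])
    show "multigraph G" by (simp add: multigraph_def G_def w_def)
    show "verts G = {1..n}" by (simp add: G_def)
    show "(\<Union>i<2. V i) = verts G" using V01(1) by (auto simp: G_def lessThan_nat_numeral lessThan_Suc)
    show "disjoint_family_on V {..<2}"
      using V01(2) by (auto simp: disjoint_family_on_def lessThan_nat_numeral lessThan_Suc)
    show "\<forall>e\<in>pairs (V 0). mult G e = a - 1" using w0 by (simp add: G_def)
    show "\<forall>i\<in>{1..<2}. \<forall>e\<in>pairs (V i). mult G e = a"
      using w1 by (auto simp: G_def V_def)
    show "\<forall>e\<in>pairs (verts G) - (\<Union>i<2. pairs (V i)). mult G e = a + 1"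
      using w2 by (simp add: G_def)
  qed
  then have "edge_prod G \<le> turan_prod 2 1 a n"
    unfolding turan_prod_def using finite_turan_multigraphs by (intro Max_ge) auto
  moreover have "edge_prod G = (a - 1) ^ (k choose 2) * a ^ ((n - k) choose 2) * (a + 1) ^ (k * (n - k))"
  proof -
    have cr: "\<forall>e\<in>cross_pairs (V 0) (V 1). w e = a + 1"
      by (rule turan_mult_cross[OF V01(2) _ _ _ w2]) (use V01 in auto)
    have "edge_prod G = prod w (pairs (V 0)) * prod w (pairs (V 1)) * prod w (cross_pairs (V 0) (V 1))"
      using V01 prod_pairs_split[of "V 0" "V 1" w] by (simp add: edge_prod_def G_def)
    also have "prod w (pairs (V 0)) = (\<Prod>e\<in>pairs (V 0). a - 1)" using w0 by (intro prod.cong) auto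
    also have "prod w (pairs (V 1)) = (\<Prod>e\<in>pairs (V 1). a)" using w1 by (intro prod.cong) auto
    also have "prod w (cross_pairs (V 0) (V 1)) = (\<Prod>e\<in>cross_pairs (V 0) (V 1). a + 1)"
      using cr by (intro prod.cong) auto
    finally show ?thesis using V01 by (simp add: card_pairs card_cross_pairs)
  qed
  ultimately show ?thesis by simp
qed

section \<open>Logarithms of multiplicities\<close>

text \<open>The unit in which weights are measured; the parameter \<open>b\<close> is the quotient
  of \<open>down_step\<close> by it.\<close>

definition up_step :: "nat \<Rightarrow> real" where
  "up_step a = ln ((real a + 1) / real a)"

definition down_step :: "nat \<Rightarrow> real" where
  "down_step a = ln (real a / (real a - 1))"

lemma up_step_pos: "a \<ge> 2 \<Longrightarrow> 0 < up_step a"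
  by (simp add: up_step_def)

lemma up_step_le_down_step:
  assumes "a \<ge> 2"
  shows "up_step a \<le> down_step a"
  unfolding up_step_def down_step_def
  using assms by (subst ln_le_cancel_iff) (auto simp: field_simps)

text \<open>Exponentiated, the claim is \<open>a ^ 11 \<le> (a + 1) ^ 7 * (a - 1) ^ 4\<close>. After
  the substitution \<open>a = c + 2\<close> the difference is a polynomial in \<open>c\<close> with
  positive coefficients.\<close>

lemma down_step_le_up_step:
  assumes "a \<ge> 2"
  shows "down_step a \<le> 7/4 * up_step a"
proof -
  obtain c where c: "a = c + 2" using assms by (metis add.commute le_Suc_ex)
  have "(c + 3) ^ 7 * (c + 1) ^ 4 = (c + 2) ^ 11 + (139 + 2587 * c + 10477 * c^2 + 20373 * c^3
      + 23262 * c^4 + 16926 * c^5 + 8106 * c^6 + 2554 * c^7 + 511 * c^8 + 59 * c^9 + 3 * c^10)"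
    by algebra
  then have "(c + 2) ^ 11 \<le> (c + 3) ^ 7 * (c + 1) ^ 4" by simp
  then have "real ((c + 2) ^ 11) \<le> real ((c + 3) ^ 7 * (c + 1) ^ 4)" by (rule of_nat_mono)
  then have le: "real a ^ 11 \<le> (real a + 1) ^ 7 * (real a - 1) ^ 4" by (simp add: c add.commute)
  have pos: "0 < real a" "0 < real a + 1" "0 < real a - 1" using assms by auto
  have "ln (real a ^ 11) \<le> ln ((real a + 1) ^ 7 * (real a - 1) ^ 4)"
    using le pos by (intro ln_mono) auto
  then have "11 * ln (real a) \<le> 7 * ln (real a + 1) + 4 * ln (real a - 1)"
    using pos by (simp add: ln_mult ln_realpow)
  then show ?thesis using pos by (simp add: up_step_def down_step_def ln_div)
qed

lemma ln_ratio_le_down_step: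
  assumes "a \<ge> 2" "0 < w" "w < a"
  shows "ln (real w / real a) \<le> - down_step a"
proof -
  have "- down_step a = ln ((real a - 1) / real a)"
    using assms by (simp add: down_step_def ln_div)
  moreover have "ln (real w / real a) \<le> ln ((real a - 1) / real a)"
    using assms by (intro ln_mono) (auto simp: divide_simps)
  ultimately show ?thesis by simp
qed

text \<open>This is \<open>\<omega> \<le> f\<close>. Bernoulli's inequality bounds the ratio by
  \<open>m\<close> equal factors, upward or downward; downward steps cost at least as much as upward
  ones gain.\<close>

lemma ln_ratio_le_up_step:
  assumes a: "a \<ge> 2" and w: "0 < w"
  shows "ln (real w / real a) \<le> up_step a * of_int (int w - int a)"
proof (cases "a \<le> w")
  case True
  then obtain m where m: "w = a + m" by (metis le_Suc_ex)
  have "real w / real a = 1 + real m * (1 / real a)" using a m by (simp add: field_simps)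
  also have "\<dots> \<le> (1 + 1 / real a) ^ m" by (rule Bernoulli_inequality) (use a in \<open>auto simp: field_simps\<close>)
  also have "1 + 1 / real a = (real a + 1) / real a" using a by (simp add: field_simps)
  finally have "ln (real w / real a) \<le> ln (((real a + 1) / real a) ^ m)"
    using a w by (intro ln_mono) auto
  also have "\<dots> = real m * up_step a" using a by (simp add: ln_realpow up_step_def)
  finally show ?thesis using m by (simp add: mult.commute)
next
  case False
  then obtain m where m: "a = w + m" by (metis le_Suc_ex nat_le_linear)
  have "real w / real a = 1 + real m * (- 1 / real a)" using a m by (simp add: field_simps)
  also have "\<dots> \<le> (1 + (- 1 / real a)) ^ m" by (rule Bernoulli_inequality) (use a in \<open>auto simp: field_simps\<close>)
  also have "1 + (- 1 / real a) = (real a - 1) / real a" using a by (simp add: field_simps)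
  finally have "ln (real w / real a) \<le> ln (((real a - 1) / real a) ^ m)"
    using a w by (intro ln_mono) auto
  also have "\<dots> = real m * ln ((real a - 1) / real a)" using a by (simp add: ln_realpow)
  also have "ln ((real a - 1) / real a) = - down_step a" using a by (simp add: down_step_def ln_div)
  also have "real m * - down_step a \<le> real m * - up_step a"
    using up_step_le_down_step[OF a] by (intro mult_left_mono) auto
  finally show ?thesis using m by (simp add: mult.commute)
qed

section \<open>Comparison of the two extremal products\<close>

lemma edge_prod_le_turan_prod:
  assumes a: "a \<ge> 2" and n: "n \<ge> 124" and G: "G \<in> sparse_multigraphs n 5 (10 * a + 5)"
  shows "edge_prod G \<le> turan_prod 2 1 a n"
\<comment> \<open>A zero product is trivial; otherwise every multiplicity is positive and its
  logarithm is meaningful.\<close>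
proof (cases "edge_prod G = 0")
  case True
  then show ?thesis by simp
next
  case False
  define V where "V = {1..n}"
  have V: "verts G = V" "finite V" "card V = n" using G by (auto simp: sparse_multigraphs_def V_def)
  have pos: "0 < mult G e" if "e \<in> pairs V" for e
    using False that V by (auto simp: edge_prod_def finite_pairs)
  define \<alpha> where "\<alpha> = up_step a"
  define b where "b = down_step a / \<alpha>"
  define f where "f e = int (mult G e) - int a" for e
  define \<omega> where "\<omega> e = ln (real (mult G e) / real a) / \<alpha>" for e
  have \<alpha>: "0 < \<alpha>" using up_step_pos[OF a] by (simp add: \<alpha>_def)
  have b: "1 \<le> b" "b \<le> 7/4"
    using up_step_le_down_step[OF a] down_step_le_up_step[OF a] \<alpha>
    by (auto simp: b_def \<alpha>_def divide_simps)
  have "sum \<omega> (pairs V) \<le> value_bound b (card V)"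
  proof (rule total_weight_le_value_bound[OF b])
    show "finite V" "5 \<le> card V" using V n by auto
    show "\<omega> e \<le> of_int (f e)" if "e \<in> pairs V" for e
      using ln_ratio_le_up_step[OF a pos[OF that]] \<alpha>
      by (simp add: \<omega>_def f_def \<alpha>_def divide_simps mult.commute)
    show "\<omega> e \<le> - b" if "e \<in> pairs V" "f e \<le> - 1" for e
      using ln_ratio_le_down_step[OF a pos[OF that(1)]] that(2) \<alpha>
      by (simp add: \<omega>_def f_def b_def divide_simps)
    show "sum f (pairs X) \<le> 5" if X: "X \<subseteq> V" "card X = 5" for X
    proof -
      have "edge_sum G X \<le> 10 * a + 5" using G X V by (auto simp: sparse_multigraphs_def)
      moreover have "finite X" using X V finite_subset by blast
      then have "card (pairs X) = 10" using X by (simp add: card_pairs choose_two)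
      then have "sum f (pairs X) = int (edge_sum G X) - 10 * int a"
        by (simp add: f_def edge_sum_def sum_subtractf)
      ultimately show ?thesis by linarith
    qed
  qed
  then have "sum \<omega> (pairs V) \<le> star_max b n"
    using value_bound_eq_star_max[OF b n] V by simp
  then obtain k where k: "k \<le> n" and le: "sum \<omega> (pairs V) \<le> star_value b n k"
    using star_max_attained[of n b] by metis
  let ?T = "(a - 1) ^ (k choose 2) * a ^ ((n - k) choose 2) * (a + 1) ^ (k * (n - k))"
  have "ln (real (edge_prod G)) = (\<Sum>e\<in>pairs V. ln (real (mult G e)))"
    unfolding edge_prod_def V(1) of_nat_prod
    by (rule ln_prod) (use pos V finite_pairs in auto)
  also have "\<dots> = (\<Sum>e\<in>pairs V. ln (real a) + \<alpha> * \<omega> e)"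
    using pos a \<alpha> by (intro sum.cong) (auto simp: \<omega>_def ln_div)
  also have "\<dots> = real (n choose 2) * ln (real a) + \<alpha> * sum \<omega> (pairs V)"
    using V by (simp add: sum.distrib sum_distrib_left card_pairs)
  also have "\<dots> \<le> real (n choose 2) * ln (real a) + \<alpha> * star_value b n k"
    using le \<alpha> by simp
  \<comment> \<open>Uses \<open>\<alpha> * b = down_step a\<close> and the splitting of
    \<open>n choose 2\<close> into the pairs inside the two parts and those across.\<close>
  also have "\<dots> = ln (real ?T)"
  proof -
    have "ln (real ?T) = real (k choose 2) * ln (real a - 1) + real ((n - k) choose 2) * ln (real a)
        + real (k * (n - k)) * ln (real a + 1)"
      using a by (simp add: ln_mult ln_realpow of_nat_diff add.commute)
    also have "ln (real a - 1) = ln (real a) - \<alpha> * b"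
      using a \<alpha> by (simp add: b_def down_step_def ln_div)
    also have "ln (real a + 1) = ln (real a) + \<alpha>"
      using a by (simp add: \<alpha>_def up_step_def ln_div)
    finally show ?thesis
      using k by (simp add: star_value_def real_choose_2 of_nat_diff field_simps)
  qed
  finally have "real (edge_prod G) \<le> real ?T"
    using False a by (subst (asm) ln_le_cancel_iff) auto
  then have "edge_prod G \<le> ?T" by (simp only: of_nat_le_iff)
  also have "\<dots> \<le> turan_prod 2 1 a n" by (rule turan_prod_ge[OF k])
  finally show ?thesis .
qed

theorem theorem3p6:
  fixes a n :: nat
  assumes "a \<ge> 2" and "n \<ge> 124"
  shows "ex_prod n 5 ((5 choose 2) * a + 5) = turan_prod 2 1 a n"
proof -
  have q: "(5 choose 2) * a + 5 = 10 * a + 5" by (simp add: choose_two)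
  have fin: "finite (sparse_multigraphs n 5 (10 * a + 5))"
    using assms by (intro finite_sparse_multigraphs) auto
  show ?thesis
    unfolding q
  proof (rule antisym)
    show "ex_prod n 5 (10 * a + 5) \<le> turan_prod 2 1 a n"
      unfolding ex_prod_def
      using fin sparse_multigraphs_nonempty edge_prod_le_turan_prod[OF assms] by simp
    show "turan_prod 2 1 a n \<le> ex_prod n 5 (10 * a + 5)"
      unfolding turan_prod_def ex_prod_def
      using fin turan_multigraphs_sparse[OF assms(1)] turan_multigraphs_nonempty[of 2]
      by (intro Max_mono image_mono) auto
  qed
qed

end
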